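(* Let $M\cong G/K$ be a semi-Riemannian globally symmetric space with associated symmetric pair of Lie algebras $(\mathfrak g,\mathfrak k)$, decomposition $\mathfrak g=\mathfrak k\oplus\mathfrak m$, base point $p$, and identification $\mathfrak m\cong T_pM$. Let $\rho:\mathfrak k\to\mathrm{End}(\mathfrak m)$ be the adjoint representation of $\mathfrak k$ on $\mathfrak m$. Suppose that $\mathfrak k$ is a reductive Lie algebra, i.e. that there exists a nondegenerate, symmetric and invariant bilinear form on $\mathfrak k$, and let $t\in\mathfrak k\otimes\mathfrak k$ be the corresponding Casimir element. Then the curvature tensor $R$ of $M$ at $p$ is the Casimir element $t$ represented in $\mathfrak m\cong T_pM$: $$R(p)=(\rho\otimes\rho)(t).$$
   Context: A semi-Riemannian symmetric pair $(G,K)$ consists of a Lie group $G$ and a closed subgroup $K$ such that (i) there is an involutive automorphism $\sigma$ of $G$ such that $K$ is contained in the group $G_\sigma$ of all fixed points of $\sigma$ and contains the identity component of $G_\sigma$; (ii) with $\theta=T_e\sigma$ and $\mathfrak m$ the $(-1)$-eigenspace of $\theta$ in $\mathfrak g=\mathrm{Lie}(G)$, there is a nondegenerate symmetric bilinear form on $\mathfrak m$ invariant under $\theta$ and under the restriction of the adjoint representation of $G_\sigma$ to $\mathfrak m$. The $(+1)$-eigenspace of $\theta$ is $\mathfrak k=\mathrm{Lie}(K)$, and $[\mathfrak k,\mathfrak k]\subset\mathfrak k$, $[\mathfrak k,\mathfrak m]\subset\mathfrak m$, $[\mathfrak m,\mathfrak m]\subset\mathfrak k$. The pair $(\mathfrak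 g,\mathfrak k)$ is also called a symmetric pair. A semi-Riemannian manifold is globally symmetric if the geodesic symmetry around every point extends to a global isometry; such a space has the form $M=G/K$, where $G$ acts isometrically, $K$ is the stabilizer of a chosen point $p$, and $\mathfrak m$ is identified with $T_pM$. The adjoint representation of $\mathfrak k$ on $\mathfrak m$ is $\rho(A)X=[A,X]$. Identifying $\mathfrak k$ with its dual via the bilinear form on $\mathfrak k$ and introducing an orthonormal basis $\{e_\alpha\}$ of $\mathfrak k$, the Casimir element is $t=\sum_\alpha e_\alpha\otimes e_\alpha$. The curvature tensor at $p$ is given by $(R(X,Y)Z)(p)=-[[X,Y],Z](p)$ for $X,Y,Z\in\mathfrak m$. It is regarded as an element of $\mathrm{End}(\mathfrak m)\otimes\mathrm{End}(\mathfrak m)$ by means of the metric $g_p$: the element $\sum_s A_s\otimes B_s$ corresponds to the tensor $R(X,Y)Z=\sum_s g_p(X,A_sY)\,B_sZ$.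
   Formalization: The invariant form on k is also required to match the metric, β([X,Y],A)=g_p(X,[Y,A]) for X,Y in m and A in k; without this the claim is false, since rescaling β rescales t but not R. For indefinite β, t carries the signs β(e,e)=±1. *)

theory Defs
  imports
    "HOL-Analysis.Analysis"
    "HOL-Algebra.Group"
    "HOL-Library.Function_Algebras"
begin

section \<open>Function spaces as real vector spaces\<close>

text \<open>Vector fields, endomorphisms and tensors are all functions here. The ring operations on
  functions are the pointwise ones of the library; with the pointwise scalar multiplication added,
  \<open>subspace\<close>, \<open>span\<close> and \<open>independent\<close> apply to sets of such functions.\<close>

instantiation "fun" :: (type, scaleR) scaleR
begin
definition scaleR_fun_def: "r *\<^sub>R f = (\<lambda>x. r *\<^sub>R f x)"
instance ..
end

lemma scaleR_fun_apply [simp]: "(r *\<^sub>R f) x = r *\<^sub>R f x"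
  by (simp add: scaleR_fun_def)

instance "fun" :: (type, real_vector) real_vector
  by standard (simp_all add: fun_eq_iff scaleR_add_right scaleR_add_left)

section \<open>Smooth manifolds and Lie groups\<close>

fun Ck_on :: "nat \<Rightarrow> 'a::real_normed_vector set \<Rightarrow> ('a \<Rightarrow> 'b::real_normed_vector) \<Rightarrow> bool" where
  "Ck_on 0 S f \<longleftrightarrow> continuous_on S f"
| "Ck_on (Suc k) S f \<longleftrightarrow> (\<forall>x\<in>S. f differentiable (at x)) \<and>
     (\<forall>v. Ck_on k S (\<lambda>x. frechet_derivative f (at x) v))"

text \<open>Meant for open \<open>S\<close> in a finite-dimensional domain, where continuity of all directional
  derivatives of order \<open>k\<close> is the usual \<open>C\<^sup>k\<close> condition.\<close>
definition smooth_on :: "'a::real_normed_vector set \<Rightarrow> ('a \<Rightarrow> 'b::real_normed_vector) \<Rightarrow> bool" where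
  "smooth_on S f \<longleftrightarrow> (\<forall>k. Ck_on k S f)"

type_synonym ('g, 'e) chart = "'g set \<times> ('g \<Rightarrow> 'e)"

definition is_chart :: "('g::topological_space, 'e::real_normed_vector) chart \<Rightarrow> bool" where
  "is_chart c \<longleftrightarrow> (case c of (U, \<phi>) \<Rightarrow>
     open U \<and> open (\<phi> ` U) \<and> homeomorphism U (\<phi> ` U) \<phi> (inv_into U \<phi>))"

text \<open>The model space is only required to be a finite-dimensional normed space, since every type of
  class \<open>euclidean_space\<close> has positive dimension.\<close>
definition smooth_atlas :: "('g::topological_space, 'e::real_normed_vector) chart set \<Rightarrow> bool" where
  "smooth_atlas \<A> \<longleftrightarrow>
     (\<exists>B :: 'e set. finite B \<and> span B = UNIV) \<and>
     (\<forall>c\<in>\<A>. is_chart c) \<and> (\<Union>(U, \<phi>)\<in>\<A>. U) = UNIV \<and>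
     (\<forall>(U, \<phi>)\<in>\<A>. \<forall>(V, \<psi>)\<in>\<A>. smooth_on (\<phi> ` (U \<inter> V)) (\<psi> \<circ> inv_into U \<phi>))"

definition smooth_map ::
  "('m::topological_space, 'e::real_normed_vector) chart set \<Rightarrow>
   ('n::topological_space, 'f::real_normed_vector) chart set \<Rightarrow> ('m \<Rightarrow> 'n) \<Rightarrow> bool" where
  "smooth_map \<A> \<B> F \<longleftrightarrow> continuous_on UNIV F \<and>
     (\<forall>(U, \<phi>)\<in>\<A>. \<forall>(V, \<psi>)\<in>\<B>. smooth_on (\<phi> ` (U \<inter> F -` V)) (\<psi> \<circ> F \<circ> inv_into U \<phi>))"

definition prod_atlas ::
  "('m, 'e) chart set \<Rightarrow> ('n, 'f) chart set \<Rightarrow> ('m \<times> 'n, 'e \<times> 'f) chart set" where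
  "prod_atlas \<A> \<B> = {(U \<times> V, map_prod \<phi> \<psi>) | U \<phi> V \<psi>. (U, \<phi>) \<in> \<A> \<and> (V, \<psi>) \<in> \<B>}"

definition smooth_functions ::
  "('m::topological_space, 'e::real_normed_vector) chart set \<Rightarrow> ('m \<Rightarrow> real) set" where
  "smooth_functions \<A> = {f. smooth_map \<A> {(UNIV, id :: real \<Rightarrow> real)} f}"

definition lie_group ::
  "('g::{t2_space, second_countable_topology}) monoid \<Rightarrow>
   ('g, 'e::real_normed_vector) chart set \<Rightarrow> bool" where
  "lie_group G \<A> \<longleftrightarrow> group G \<and> carrier G = UNIV \<and> smooth_atlas \<A> \<and>
     smooth_map (prod_atlas \<A> \<A>) \<A> (\<lambda>(x, y). x \<otimes>\<^bsub>G\<^esub> y) \<and>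
     smooth_map \<A> \<A> (\<lambda>x. inv\<^bsub>G\<^esub> x)"

section \<open>The Lie algebra of a Lie group\<close>

type_synonym 'm operator = "('m \<Rightarrow> real) \<Rightarrow> ('m \<Rightarrow> real)"

text \<open>Smooth vector fields are the derivations of the algebra of smooth functions. Outside that
  algebra their values are fixed to be 0, so that equality of vector fields is equality of
  operators.\<close>
definition vector_fields ::
  "('m::topological_space, 'e::real_normed_vector) chart set \<Rightarrow> 'm operator set" where
  "vector_fields \<A> = {D.
     (\<forall>f\<in>smooth_functions \<A>. D f \<in> smooth_functions \<A>) \<and>
     (\<forall>f\<in>smooth_functions \<A>. \<forall>h\<in>smooth_functions \<A>. D (f + h) = D f + D h) \<and>
     (\<forall>c. \<forall>f\<in>smooth_functions \<A>. D (c *\<^sub>R f) = c *\<^sub>R D f) \<and>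
     (\<forall>f\<in>smooth_functions \<A>. \<forall>h\<in>smooth_functions \<A>. D (f * h) = f * D h + h * D f) \<and>
     (\<forall>f. f \<notin> smooth_functions \<A> \<longrightarrow> D f = 0)}"

definition lie_bracket :: "'m operator \<Rightarrow> 'm operator \<Rightarrow> 'm operator" where
  "lie_bracket D E = (\<lambda>f. D (E f) - E (D f))"

definition lie_algebra ::
  "('g::topological_space, 'b) monoid_scheme \<Rightarrow> ('g, 'e::real_normed_vector) chart set \<Rightarrow>
   'g operator set" where
  "lie_algebra G \<A> = {D\<in>vector_fields \<A>. \<forall>a\<in>carrier G. \<forall>f\<in>smooth_functions \<A>.
     D (f \<circ> (\<lambda>x. a \<otimes>\<^bsub>G\<^esub> x)) = D f \<circ> (\<lambda>x. a \<otimes>\<^bsub>G\<^esub> x)}"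

text \<open>Push-forward of vector fields along a diffeomorphism. On left-invariant vector fields,
  identified with tangent vectors at the identity, the push-forward along an automorphism is the
  differential of that automorphism at the identity.\<close>
definition pushforward :: "('m \<Rightarrow> 'm) \<Rightarrow> 'm operator \<Rightarrow> 'm operator" where
  "pushforward F D = (\<lambda>f. D (f \<circ> F) \<circ> inv_into UNIV F)"

definition Ad :: "('g, 'b) monoid_scheme \<Rightarrow> 'g \<Rightarrow> 'g operator \<Rightarrow> 'g operator" where
  "Ad G a = pushforward (\<lambda>x. a \<otimes>\<^bsub>G\<^esub> x \<otimes>\<^bsub>G\<^esub> inv\<^bsub>G\<^esub> a)"

section \<open>Bilinear maps on subspaces\<close>

definition bilinear_on ::
  "'u::real_vector set \<Rightarrow> 'v::real_vector set \<Rightarrow> ('u \<Rightarrow> 'v \<Rightarrow> real) \<Rightarrow> bool" where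
  "bilinear_on U V \<beta> \<longleftrightarrow>
     (\<forall>x\<in>U. \<forall>x'\<in>U. \<forall>y\<in>V. \<beta> (x + x') y = \<beta> x y + \<beta> x' y) \<and>
     (\<forall>c. \<forall>x\<in>U. \<forall>y\<in>V. \<beta> (c *\<^sub>R x) y = c * \<beta> x y) \<and>
     (\<forall>x\<in>U. \<forall>y\<in>V. \<forall>y'\<in>V. \<beta> x (y + y') = \<beta> x y + \<beta> x y') \<and>
     (\<forall>c. \<forall>x\<in>U. \<forall>y\<in>V. \<beta> x (c *\<^sub>R y) = c * \<beta> x y)"

definition nondegenerate_symmetric_form ::
  "'v::real_vector set \<Rightarrow> ('v \<Rightarrow> 'v \<Rightarrow> real) \<Rightarrow> bool" where
  "nondegenerate_symmetric_form V \<beta> \<longleftrightarrow> bilinear_on V V \<beta> \<and>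
     (\<forall>x\<in>V. \<forall>y\<in>V. \<beta> x y = \<beta> y x) \<and>
     (\<forall>x\<in>V. (\<forall>y\<in>V. \<beta> x y = 0) \<longrightarrow> x = 0)"

definition invariant_under :: "'v set \<Rightarrow> ('v \<Rightarrow> 'v) \<Rightarrow> ('v \<Rightarrow> 'v \<Rightarrow> real) \<Rightarrow> bool" where
  "invariant_under V F \<beta> \<longleftrightarrow> (\<forall>x\<in>V. \<forall>y\<in>V. \<beta> (F x) (F y) = \<beta> x y)"

definition ad_invariant_form ::
  "'g operator set \<Rightarrow> ('g operator \<Rightarrow> 'g operator \<Rightarrow> real) \<Rightarrow> bool" where
  "ad_invariant_form \<kk> \<beta> \<longleftrightarrow>
     (\<forall>A\<in>\<kk>. \<forall>B\<in>\<kk>. \<forall>C\<in>\<kk>. \<beta> (lie_bracket A B) C + \<beta> B (lie_bracket A C) = 0)"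

section \<open>Semi-Riemannian symmetric pairs\<close>

text \<open>The eigenspaces of the differential of \<open>\<sigma>\<close> at the identity. As \<open>K\<close> lies between the fixed
  group of \<open>\<sigma>\<close> and its identity component, the eigenspace for 1 is the Lie algebra of \<open>K\<close>.\<close>
definition k_part ::
  "('g::topological_space, 'b) monoid_scheme \<Rightarrow> ('g, 'e::real_normed_vector) chart set \<Rightarrow>
   ('g \<Rightarrow> 'g) \<Rightarrow> 'g operator set" where
  "k_part G \<A> \<sigma> = {D\<in>lie_algebra G \<A>. pushforward \<sigma> D = D}"

definition m_part ::
  "('g::topological_space, 'b) monoid_scheme \<Rightarrow> ('g, 'e::real_normed_vector) chart set \<Rightarrow>
   ('g \<Rightarrow> 'g) \<Rightarrow> 'g operator set" where
  "m_part G \<A> \<sigma> = {D\<in>lie_algebra G \<A>. pushforward \<sigma> D = - D}"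

definition fixed_group :: "('g \<Rightarrow> 'g) \<Rightarrow> 'g set" where
  "fixed_group \<sigma> = {x. \<sigma> x = x}"

definition semi_riemannian_symmetric_pair ::
  "('g::{t2_space, second_countable_topology}) monoid \<Rightarrow>
   ('g, 'e::real_normed_vector) chart set \<Rightarrow> 'g set \<Rightarrow> ('g \<Rightarrow> 'g) \<Rightarrow> bool" where
  "semi_riemannian_symmetric_pair G \<A> K \<sigma> \<longleftrightarrow>
     lie_group G \<A> \<and> subgroup K G \<and> closed K \<and>
     \<sigma> \<in> iso G G \<and> smooth_map \<A> \<A> \<sigma> \<and> \<sigma> \<circ> \<sigma> = id \<and>
     K \<subseteq> fixed_group \<sigma> \<and> connected_component_set (fixed_group \<sigma>) \<one>\<^bsub>G\<^esub> \<subseteq> K \<and>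
     (\<exists>\<beta>. nondegenerate_symmetric_form (m_part G \<A> \<sigma>) \<beta> \<and>
        invariant_under (m_part G \<A> \<sigma>) (pushforward \<sigma>) \<beta> \<and>
        (\<forall>a\<in>fixed_group \<sigma>. invariant_under (m_part G \<A> \<sigma>) (Ad G a) \<beta>))"

text \<open>The value \<open>g\<^sub>p\<close> at the base point of a semi-Riemannian metric on \<open>M = G/K\<close> for which \<open>G\<close> acts
  by isometries, as a bilinear form on \<open>\<mm> \<cong> T\<^sub>pM\<close>. By transitivity, such metrics correspond to the
  forms on \<open>\<mm>\<close> that are invariant under the isotropy representation of the stabilizer \<open>K\<close>.\<close>
definition base_point_metric ::
  "('g::topological_space, 'b) monoid_scheme \<Rightarrow> ('g, 'e::real_normed_vector) chart set \<Rightarrow>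
   'g set \<Rightarrow> ('g \<Rightarrow> 'g) \<Rightarrow> ('g operator \<Rightarrow> 'g operator \<Rightarrow> real) \<Rightarrow> bool" where
  "base_point_metric G \<A> K \<sigma> g \<longleftrightarrow>
     nondegenerate_symmetric_form (m_part G \<A> \<sigma>) g \<and>
     (\<forall>a\<in>K. invariant_under (m_part G \<A> \<sigma>) (Ad G a) g)"

text \<open>Given that \<open>\<beta>\<close> is invariant under \<open>ad \<kk>\<close> and \<open>g\<close> under the action of \<open>\<kk>\<close>, this is equivalent
  to invariance of the orthogonal sum \<open>\<beta> \<oplus> g\<close> on \<open>\<kk> \<oplus> \<mm>\<close> under the adjoint representation of the
  whole Lie algebra. It fixes the normalization of \<open>\<beta>\<close> relative to the metric; without
  such a condition the curvature cannot be expected to equal the Casimir element, because rescaling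
  \<open>\<beta>\<close> rescales the Casimir element but not the curvature.\<close>
definition compatible_forms ::
  "'g operator set \<Rightarrow> 'g operator set \<Rightarrow> ('g operator \<Rightarrow> 'g operator \<Rightarrow> real) \<Rightarrow>
   ('g operator \<Rightarrow> 'g operator \<Rightarrow> real) \<Rightarrow> bool" where
  "compatible_forms \<kk> \<mm> \<beta> g \<longleftrightarrow>
     (\<forall>A\<in>\<kk>. \<forall>X\<in>\<mm>. \<forall>Y\<in>\<mm>. \<beta> (lie_bracket X Y) A = g X (lie_bracket Y A))"

section \<open>Tensor products\<close>

text \<open>The algebraic tensor product \<open>U \<otimes> V\<close> is realized in the dual of the space of bilinear forms on
  \<open>U \<times> V\<close>, with \<open>u \<otimes> v\<close> acting as evaluation at \<open>(u, v)\<close>. Over a field the canonical map from the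
  tensor product to this dual is injective, in any dimension.\<close>

type_synonym ('u, 'v) tensor = "('u \<Rightarrow> 'v \<Rightarrow> real) \<Rightarrow> real"

definition pure_tensor ::
  "'u::real_vector set \<Rightarrow> 'v::real_vector set \<Rightarrow> 'u \<Rightarrow> 'v \<Rightarrow> ('u, 'v) tensor" where
  "pure_tensor U V u v = (\<lambda>\<beta>. if bilinear_on U V \<beta> then \<beta> u v else 0)"

text \<open>The map \<open>F \<otimes> H\<close> from tensors over \<open>U \<times> V\<close> to tensors over \<open>U' \<times> V'\<close> induced by linear maps
  \<open>F : U \<rightarrow> U'\<close> and \<open>H : V \<rightarrow> V'\<close>; it sends \<open>u \<otimes> v\<close> to \<open>F u \<otimes> H v\<close>.\<close>
definition tensor_map ::
  "'u'::real_vector set \<Rightarrow> 'v'::real_vector set \<Rightarrow> ('u \<Rightarrow> 'u') \<Rightarrow> ('v \<Rightarrow> 'v') \<Rightarrow>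
   ('u, 'v) tensor \<Rightarrow> ('u', 'v') tensor" where
  "tensor_map U' V' F H T =
     (\<lambda>\<beta>. if bilinear_on U' V' \<beta> then T (\<lambda>u v. \<beta> (F u) (H v)) else 0)"

definition orthonormal_basis_of ::
  "'v::real_vector set \<Rightarrow> ('v \<Rightarrow> 'v \<Rightarrow> real) \<Rightarrow> 'v set \<Rightarrow> bool" where
  "orthonormal_basis_of V \<beta> E \<longleftrightarrow> finite E \<and> independent E \<and> span E = V \<and>
     (\<forall>x\<in>E. \<beta> x x = 1 \<or> \<beta> x x = -1) \<and> (\<forall>x\<in>E. \<forall>y\<in>E. x \<noteq> y \<longrightarrow> \<beta> x y = 0)"

text \<open>The factor \<open>\<beta> e e = \<plusminus>1\<close> is the sign of the basis vector; it is what makes the sum independent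
  of the orthonormal basis (it equals the sum of \<open>e\<^sub>\<alpha> \<otimes> e\<^sup>\<alpha>\<close> over dual bases) when \<open>\<beta>\<close> is not
  positive definite.\<close>
definition casimir_element ::
  "'v::real_vector set \<Rightarrow> ('v \<Rightarrow> 'v \<Rightarrow> real) \<Rightarrow> ('v, 'v) tensor \<Rightarrow> bool" where
  "casimir_element V \<beta> t \<longleftrightarrow>
     (\<exists>E. orthonormal_basis_of V \<beta> E \<and> t = (\<Sum>e\<in>E. \<beta> e e *\<^sub>R pure_tensor V V e e))"

section \<open>Adjoint representation and curvature\<close>

text \<open>Endomorphisms of a subspace are extended by 0, so that they form a vector space of functions.\<close>
definition endomorphisms :: "'v::real_vector set \<Rightarrow> ('v \<Rightarrow> 'v) set" where
  "endomorphisms V = {A. (\<forall>x\<in>V. A x \<in> V) \<and>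
     (\<forall>x\<in>V. \<forall>y\<in>V. A (x + y) = A x + A y) \<and> (\<forall>c. \<forall>x\<in>V. A (c *\<^sub>R x) = c *\<^sub>R A x) \<and>
     (\<forall>x. x \<notin> V \<longrightarrow> A x = 0)}"

definition adjoint_rep :: "'g operator set \<Rightarrow> 'g operator \<Rightarrow> ('g operator \<Rightarrow> 'g operator)" where
  "adjoint_rep \<mm> A = (\<lambda>X. if X \<in> \<mm> then lie_bracket A X else 0)"

text \<open>Curvature tensor of the symmetric space at the base point, with \<open>\<mm>\<close> identified with the
  tangent space. This is the classical formula for the curvature of the Levi-Civita connection,
  taken here as the definition.\<close>
definition curvature :: "'g operator \<Rightarrow> 'g operator \<Rightarrow> 'g operator \<Rightarrow> 'g operator" where
  "curvature X Y Z = - lie_bracket (lie_bracket X Y) Z"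

definition tensor_corresponds ::
  "'v::real_vector set \<Rightarrow> ('v \<Rightarrow> 'v \<Rightarrow> real) \<Rightarrow> ('v \<Rightarrow> 'v, 'v \<Rightarrow> 'v) tensor \<Rightarrow>
   ('v \<Rightarrow> 'v \<Rightarrow> 'v \<Rightarrow> 'v) \<Rightarrow> bool" where
  "tensor_corresponds V g T R \<longleftrightarrow>
     (\<exists>(n::nat) A B. (\<forall>s<n. A s \<in> endomorphisms V \<and> B s \<in> endomorphisms V) \<and>
        T = (\<Sum>s<n. pure_tensor (endomorphisms V) (endomorphisms V) (A s) (B s)) \<and>
        (\<forall>X\<in>V. \<forall>Y\<in>V. \<forall>Z\<in>V. R X Y Z = (\<Sum>s<n. g X (A s Y) *\<^sub>R B s Z)))"

text \<open>Since \<open>g\<close> is nondegenerate, at most one tensor corresponds to the curvature; since \<open>\<mm>\<close> is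
  finite-dimensional, one exists.\<close>
definition curvature_tensor ::
  "'g operator set \<Rightarrow> ('g operator \<Rightarrow> 'g operator \<Rightarrow> real) \<Rightarrow>
   ('g operator \<Rightarrow> 'g operator, 'g operator \<Rightarrow> 'g operator) tensor" where
  "curvature_tensor \<mm> g = (THE T. tensor_corresponds \<mm> g T curvature)"

end

theory Submission
  imports Defs
begin

text \<open>Expanding \<open>[X, Y] \<in> \<kk>\<close> in the orthonormal basis and using
  \<open>\<beta>([X, Y], e) = g(X, [Y, e]) = - g(X, [e, Y])\<close> turns \<open>- [[X, Y], Z]\<close> into
  \<open>\<Sum>\<^sub>e \<beta>(e, e) g(X, [e, Y]) [e, Z]\<close>, so the represented Casimir element corresponds to the
  curvature. Uniqueness of the corresponding tensor needs no dimension count: writing a difference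
  as \<open>\<Sum>\<^sub>c A\<^sub>c \<otimes> c\<close> with linearly independent \<open>c\<close>, one reads off \<open>g(X, A\<^sub>c Y) = 0\<close>, hence
  \<open>A\<^sub>c = 0\<close>.\<close>

section \<open>The algebra of smooth functions\<close>

text \<open>A derivative at a point depends only on values nearby, and openness of \<open>S\<close>
  keeps a neighbourhood inside \<open>S\<close>. The closure proofs below use this to replace the
  derivative of a sum or product by the formula that the differentiation rule gives on
  \<open>S\<close>.\<close>

lemma Ck_on_cong:
  assumes "open S" "\<And>x. x \<in> S \<Longrightarrow> f x = h x" "Ck_on k S f"
  shows "Ck_on k S h"
  using assms(2,3)
proof (induction k arbitrary: f h)
  case 0
  then show ?case
    using continuous_on_cong[of S S f h] by simp
next
  case (Suc k)
  have diff: "f differentiable (at x)" if "x \<in> S" for x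
    using Suc.prems that by simp
  have "h differentiable (at x)" if "x \<in> S" for x
    using diff[OF that] Suc.prems(1) \<open>open S\<close> that
    by (meson differentiable_def has_derivative_transform_within_open)
  moreover have "Ck_on k S (\<lambda>x. frechet_derivative h (at x) v)" for v
  proof (rule Suc.IH)
    show "Ck_on k S (\<lambda>x. frechet_derivative f (at x) v)"
      using Suc.prems(2) by simp
    show "frechet_derivative f (at x) v = frechet_derivative h (at x) v" if "x \<in> S" for x
      using frechet_derivative_transform_within_open[OF diff[OF that] \<open>open S\<close> that] Suc.prems(1)
      by simp
  qed
  ultimately show ?case
    by simp
qed

lemma Ck_on_Suc_imp_Ck_on: "Ck_on (Suc k) S f \<Longrightarrow> Ck_on k S f"
proof (induction k arbitrary: f)
  case 0
  then show ?case
    by (auto intro!: continuous_at_imp_continuous_on differentiable_imp_continuous_within)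
next
  case (Suc k)
  then show ?case
    by (metis Ck_on.simps(2))
qed

lemma Ck_on_const: "Ck_on k S (\<lambda>x. c)"
  by (induction k arbitrary: c) simp_all

lemma Ck_on_add:
  assumes "open S" "Ck_on k S f" "Ck_on k S h"
  shows "Ck_on k S (\<lambda>x. f x + h x)"
  using assms(2,3)
proof (induction k arbitrary: f h)
  case 0
  then show ?case
    by (simp add: continuous_on_add)
next
  case (Suc k)
  have "Ck_on k S (\<lambda>x. frechet_derivative (\<lambda>x. f x + h x) (at x) v)" for v
  proof (rule Ck_on_cong[OF \<open>open S\<close>])
    show "Ck_on k S (\<lambda>x. frechet_derivative f (at x) v + frechet_derivative h (at x) v)"
      using Suc by simp
    show "frechet_derivative f (at x) v + frechet_derivative h (at x) v =
        frechet_derivative (\<lambda>x. f x + h x) (at x) v" if "x \<in> S" for x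
    proof -
      have "(f has_derivative frechet_derivative f (at x)) (at x)"
        "(h has_derivative frechet_derivative h (at x)) (at x)"
        using Suc.prems that by (auto simp: frechet_derivative_works[symmetric])
      from frechet_derivative_at[OF has_derivative_add[OF this]] show ?thesis
        by metis
    qed
  qed
  then show ?case
    using Suc.prems by auto
qed

lemma Ck_on_mult:
  fixes f h :: "'a::real_normed_vector \<Rightarrow> real"
  assumes "open S" "Ck_on k S f" "Ck_on k S h"
  shows "Ck_on k S (\<lambda>x. f x * h x)"
  using assms(2,3)
proof (induction k arbitrary: f h)
  case 0
  then show ?case
    by (simp add: continuous_on_mult)
next
  case (Suc k)
  \<comment> \<open>The product rule leaves one factor undifferentiated in each term, so the
    induction hypothesis is also applied to \<open>f\<close> and \<open>h\<close>
    themselves.\<close>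
  have lower: "Ck_on k S f" "Ck_on k S h"
    using Suc.prems by (auto intro: Ck_on_Suc_imp_Ck_on)
  have "Ck_on k S (\<lambda>x. frechet_derivative (\<lambda>x. f x * h x) (at x) v)" for v
  proof (rule Ck_on_cong[OF \<open>open S\<close>])
    show "Ck_on k S
        (\<lambda>x. f x * frechet_derivative h (at x) v + frechet_derivative f (at x) v * h x)"
      using Suc lower by (intro Ck_on_add \<open>open S\<close> Suc.IH) simp_all
    show "f x * frechet_derivative h (at x) v + frechet_derivative f (at x) v * h x =
        frechet_derivative (\<lambda>x. f x * h x) (at x) v" if "x \<in> S" for x
    proof -
      have "(f has_derivative frechet_derivative f (at x)) (at x)"
        "(h has_derivative frechet_derivative h (at x)) (at x)"
        using Suc.prems that by (auto simp: frechet_derivative_works[symmetric])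
      from frechet_derivative_at[OF has_derivative_mult[OF this]] show ?thesis
        by metis
    qed
  qed
  then show ?case
    using Suc.prems by auto
qed

text \<open>The only target chart is the identity on the whole line, so the preimage in
  \<open>smooth_map\<close> is everything and disappears.\<close>

lemma smooth_functions_iff:
  "f \<in> smooth_functions \<A> \<longleftrightarrow> continuous_on UNIV f \<and>
     (\<forall>U \<phi>. (U, \<phi>) \<in> \<A> \<longrightarrow> (\<forall>k. Ck_on k (\<phi> ` U) (\<lambda>x. f (inv_into U \<phi> x))))"
  by (auto simp: smooth_functions_def smooth_map_def smooth_on_def comp_def)

lemma smooth_atlas_open_image:
  assumes "smooth_atlas \<A>" "(U, \<phi>) \<in> \<A>"
  shows "open (\<phi> ` U)"
  using assms by (auto simp: smooth_atlas_def is_chart_def)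

lemma const_in_smooth_functions: "(\<lambda>x. c) \<in> smooth_functions \<A>"
  by (simp add: smooth_functions_iff Ck_on_const)

lemma zero_in_smooth_functions: "0 \<in> smooth_functions \<A>"
  using const_in_smooth_functions[of 0] by (simp add: zero_fun_def)

lemma smooth_functions_add:
  assumes "smooth_atlas \<A>" "f \<in> smooth_functions \<A>" "h \<in> smooth_functions \<A>"
  shows "f + h \<in> smooth_functions \<A>"
  using assms smooth_atlas_open_image[OF assms(1)]
  by (auto simp: smooth_functions_iff plus_fun_def continuous_on_add Ck_on_add)

lemma smooth_functions_mult:
  assumes "smooth_atlas \<A>" "f \<in> smooth_functions \<A>" "h \<in> smooth_functions \<A>"
  shows "f * h \<in> smooth_functions \<A>"
  using assms smooth_atlas_open_image[OF assms(1)]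
  by (auto simp: smooth_functions_iff times_fun_def continuous_on_mult Ck_on_mult)

lemma smooth_functions_scaleR:
  assumes "smooth_atlas \<A>" "f \<in> smooth_functions \<A>"
  shows "c *\<^sub>R f \<in> smooth_functions \<A>"
proof -
  have "c *\<^sub>R f = (\<lambda>x. c) * f"
    by (simp add: fun_eq_iff)
  then show ?thesis
    using assms smooth_functions_mult const_in_smooth_functions by metis
qed

lemma smooth_functions_diff:
  assumes "smooth_atlas \<A>" "f \<in> smooth_functions \<A>" "h \<in> smooth_functions \<A>"
  shows "f - h \<in> smooth_functions \<A>"
  using smooth_functions_add[OF assms(1,2) smooth_functions_scaleR[OF assms(1,3), of "-1"]]
  by simp

section \<open>Vector fields and the Lie bracket\<close>

lemma vector_field_add:
  "\<lbrakk>D \<in> vector_fields \<A>; f \<in> smooth_functions \<A>; h \<in> smooth_functions \<A>\<rbrakk> \<Longrightarrow> D (f + h) = D f + D h"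
  by (simp add: vector_fields_def)

lemma vector_field_scaleR:
  "\<lbrakk>D \<in> vector_fields \<A>; f \<in> smooth_functions \<A>\<rbrakk> \<Longrightarrow> D (c *\<^sub>R f) = c *\<^sub>R D f"
  by (simp add: vector_fields_def)

lemma vector_field_mult:
  "\<lbrakk>D \<in> vector_fields \<A>; f \<in> smooth_functions \<A>; h \<in> smooth_functions \<A>\<rbrakk> \<Longrightarrow>
    D (f * h) = f * D h + h * D f"
  by (simp add: vector_fields_def)

lemma vector_field_outside:
  "\<lbrakk>D \<in> vector_fields \<A>; f \<notin> smooth_functions \<A>\<rbrakk> \<Longrightarrow> D f = 0"
  by (simp add: vector_fields_def)

text \<open>This needs no condition on \<open>f\<close>: off the algebra the value is fixed to be 0,
  which is smooth. The bracket identities below can therefore be proved for every argument.\<close>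

lemma vector_field_smooth: "D \<in> vector_fields \<A> \<Longrightarrow> D f \<in> smooth_functions \<A>"
  by (cases "f \<in> smooth_functions \<A>")
    (auto simp: vector_fields_def zero_in_smooth_functions)

lemma vector_field_zero: "D \<in> vector_fields \<A> \<Longrightarrow> D 0 = 0"
  using vector_field_scaleR[OF _ zero_in_smooth_functions, of D \<A> 0] by simp

lemma vector_field_minus:
  "\<lbrakk>D \<in> vector_fields \<A>; f \<in> smooth_functions \<A>\<rbrakk> \<Longrightarrow> D (- f) = - D f"
  using vector_field_scaleR[of D \<A> f "-1"] by simp

lemma lie_bracket_minus_swap: "lie_bracket D E = - lie_bracket E D"
  by (simp add: lie_bracket_def fun_eq_iff)

text \<open>Additivity of \<open>D\<close> is needed only where \<open>D\<close> acts on
  \<open>E f + E' f\<close>, and both summands are smooth for every \<open>f\<close>. The other term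
  is additive pointwise.\<close>

lemma lie_bracket_add_right:
  assumes "D \<in> vector_fields \<A>" "E \<in> vector_fields \<A>" "E' \<in> vector_fields \<A>"
  shows "lie_bracket D (E + E') = lie_bracket D E + lie_bracket D E'"
  using vector_field_add[OF assms(1) vector_field_smooth[OF assms(2)]
      vector_field_smooth[OF assms(3)]]
  by (simp add: lie_bracket_def fun_eq_iff)

lemma lie_bracket_scaleR_right:
  assumes "D \<in> vector_fields \<A>" "E \<in> vector_fields \<A>"
  shows "lie_bracket D (c *\<^sub>R E) = c *\<^sub>R lie_bracket D E"
  using vector_field_scaleR[OF assms(1) vector_field_smooth[OF assms(2)]]
  by (simp add: lie_bracket_def fun_eq_iff right_diff_distrib)

lemma lie_bracket_add_left:
  assumes "D \<in> vector_fields \<A>" "D' \<in> vector_fields \<A>" "E \<in> vector_fields \<A>"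
  shows "lie_bracket (D + D') E = lie_bracket D E + lie_bracket D' E"
  using lie_bracket_add_right[OF assms(3,1,2)]
  by (simp add: lie_bracket_minus_swap[of _ E])

lemma lie_bracket_scaleR_left:
  assumes "D \<in> vector_fields \<A>" "E \<in> vector_fields \<A>"
  shows "lie_bracket (c *\<^sub>R D) E = c *\<^sub>R lie_bracket D E"
  using lie_bracket_scaleR_right[OF assms(2,1)]
  by (simp add: lie_bracket_minus_swap[of _ E])

lemma vector_fields_subspace:
  assumes "smooth_atlas \<A>"
  shows "subspace (vector_fields \<A>)"
  unfolding subspace_def vector_fields_def
  by (auto simp: zero_in_smooth_functions smooth_functions_add smooth_functions_scaleR assms
      fun_eq_iff algebra_simps)

lemma lie_bracket_sum_left:
  assumes "smooth_atlas \<A>" "E \<in> vector_fields \<A>" "\<And>i. i \<in> I \<Longrightarrow> D i \<in> vector_fields \<A>"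
  shows "lie_bracket (\<Sum>i\<in>I. r i *\<^sub>R D i) E = (\<Sum>i\<in>I. r i *\<^sub>R lie_bracket (D i) E)"
  using assms(3)
proof (induction I rule: infinite_finite_induct)
  case (insert i I)
  have vf: "D i \<in> vector_fields \<A>" "(\<Sum>i\<in>I. r i *\<^sub>R D i) \<in> vector_fields \<A>"
    "r i *\<^sub>R D i \<in> vector_fields \<A>"
    using insert.prems vector_fields_subspace[OF assms(1)]
    by (auto intro!: subspace_sum subspace_scale)
  have "lie_bracket (\<Sum>i\<in>insert i I. r i *\<^sub>R D i) E =
      lie_bracket (r i *\<^sub>R D i) E + lie_bracket (\<Sum>i\<in>I. r i *\<^sub>R D i) E"
    unfolding sum.insert[OF insert.hyps(1,2)] by (rule lie_bracket_add_left[OF vf(3,2) assms(2)])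
  also have "\<dots> = r i *\<^sub>R lie_bracket (D i) E + (\<Sum>i\<in>I. r i *\<^sub>R lie_bracket (D i) E)"
    by (intro arg_cong2[of _ _ _ _ "(+)"] lie_bracket_scaleR_left[OF vf(1) assms(2)]
        insert.IH insert.prems insertI2)
  finally show ?case
    unfolding sum.insert[OF insert.hyps(1,2)] .
\<comment> \<open>For an empty or infinite index set the sum is 0;
  \<open>lie_bracket 0 E = 0\<close> is homogeneity with factor 0, with \<open>E\<close> itself in
  the left slot.\<close>
qed (use lie_bracket_scaleR_left[OF assms(2,2), of 0] in simp_all)

text \<open>A composite of two derivations violates the Leibniz rule by the mixed products
  \<open>D f * E h\<close> and \<open>E f * D h\<close>. They are symmetric in \<open>D\<close> and
  \<open>E\<close> and cancel in the commutator.\<close>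

lemma lie_bracket_in_vector_fields:
  assumes "smooth_atlas \<A>" and D: "D \<in> vector_fields \<A>" and E: "E \<in> vector_fields \<A>"
  shows "lie_bracket D E \<in> vector_fields \<A>"
proof -
  note sm = vector_field_smooth[OF D] vector_field_smooth[OF E]
    smooth_functions_mult[OF assms(1)]
  have "lie_bracket D E (f * h) = f * lie_bracket D E h + h * lie_bracket D E f"
    if "f \<in> smooth_functions \<A>" "h \<in> smooth_functions \<A>" for f h
    using that
    by (simp add: lie_bracket_def vector_field_mult[OF D] vector_field_mult[OF E]
        vector_field_add[OF D] vector_field_add[OF E] sm)
      (simp add: algebra_simps)
  moreover have "lie_bracket D E f = 0" if "f \<notin> smooth_functions \<A>" for f
    using that by (simp add: lie_bracket_def vector_field_outside[OF D] vector_field_outside[OF E]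
        vector_field_zero[OF D] vector_field_zero[OF E])
  ultimately show ?thesis
    unfolding vector_fields_def
    by (simp add: lie_bracket_def vector_field_add[OF D] vector_field_add[OF E]
        vector_field_scaleR[OF D] vector_field_scaleR[OF E] sm smooth_functions_diff[OF assms(1)]
        scaleR_diff_right)
qed

section \<open>The symmetric decomposition\<close>

lemma lie_algebra_subspace:
  assumes "smooth_atlas \<A>"
  shows "subspace (lie_algebra G \<A>)"
  using vector_fields_subspace[OF assms] unfolding subspace_def lie_algebra_def
  by (auto simp: fun_eq_iff)

lemma lie_bracket_in_lie_algebra:
  assumes "smooth_atlas \<A>" and "D \<in> lie_algebra G \<A>" and "E \<in> lie_algebra G \<A>"
  shows "lie_bracket D E \<in> lie_algebra G \<A>"
proof -
  have DE: "D \<in> vector_fields \<A>" "E \<in> vector_fields \<A>"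
    using assms by (auto simp: lie_algebra_def)
  have "lie_bracket D E (f \<circ> (\<lambda>x. a \<otimes>\<^bsub>G\<^esub> x)) = lie_bracket D E f \<circ> (\<lambda>x. a \<otimes>\<^bsub>G\<^esub> x)"
    if "a \<in> carrier G" "f \<in> smooth_functions \<A>" for a f
  proof -
    have "D (u \<circ> (\<lambda>x. a \<otimes>\<^bsub>G\<^esub> x)) = D u \<circ> (\<lambda>x. a \<otimes>\<^bsub>G\<^esub> x)"
      "E (u \<circ> (\<lambda>x. a \<otimes>\<^bsub>G\<^esub> x)) = E u \<circ> (\<lambda>x. a \<otimes>\<^bsub>G\<^esub> x)"
      if "u \<in> smooth_functions \<A>" for u
      using assms(2,3) \<open>a \<in> carrier G\<close> that unfolding lie_algebra_def by blast+
    \<comment> \<open>Invariance is available on smooth functions only; it is used first on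
      \<open>f\<close> and then on \<open>E f\<close> and \<open>D f\<close>.\<close>
    then have "D (E (f \<circ> (\<lambda>x. a \<otimes>\<^bsub>G\<^esub> x))) = D (E f) \<circ> (\<lambda>x. a \<otimes>\<^bsub>G\<^esub> x)"
      "E (D (f \<circ> (\<lambda>x. a \<otimes>\<^bsub>G\<^esub> x))) = E (D f) \<circ> (\<lambda>x. a \<otimes>\<^bsub>G\<^esub> x)"
      using that(2) DE[THEN vector_field_smooth] by metis+
    then show ?thesis
      by (simp only: lie_bracket_def) (simp add: fun_eq_iff)
  qed
  then show ?thesis
    using lie_bracket_in_vector_fields[OF assms(1) DE] by (simp add: lie_algebra_def)
qed

text \<open>An involution is its own inverse, so composition with \<open>\<sigma>\<close> can be
  moved across the equation. The eigenvalue conditions thus become rules for moving an operator past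
  \<open>\<sigma>\<close>, with a sign on the (-1)-eigenspace.\<close>

lemma pushforward_eq_iff:
  assumes "\<sigma> \<circ> \<sigma> = id"
  shows "pushforward \<sigma> D = E \<longleftrightarrow> (\<forall>f. D (f \<circ> \<sigma>) = E f \<circ> \<sigma>)"
proof -
  have "inv_into UNIV \<sigma> = \<sigma>"
    using assms inv_unique_comp by blast
  moreover have "u \<circ> \<sigma> = v \<longleftrightarrow> u = v \<circ> \<sigma>" for u v :: "'a \<Rightarrow> real"
    using assms by (metis comp_assoc comp_id)
  ultimately show ?thesis
    by (simp add: pushforward_def fun_eq_iff[of "\<lambda>f. D (f \<circ> \<sigma>) \<circ> \<sigma>"])
qed

lemma m_part_subspace:
  assumes "smooth_atlas \<A>" "\<sigma> \<circ> \<sigma> = id"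
  shows "subspace (m_part G \<A> \<sigma>)"
  using lie_algebra_subspace[OF assms(1), of G]
  unfolding subspace_def m_part_def pushforward_eq_iff[OF assms(2)]
  by (auto simp: fun_eq_iff)

text \<open>Each of \<open>X\<close> and \<open>Y\<close> changes sign when moved past
  \<open>\<sigma>\<close>, and the two signs cancel.\<close>

lemma bracket_m_m:
  assumes "smooth_atlas \<A>" and sigma: "\<sigma> \<circ> \<sigma> = id"
    and X: "X \<in> m_part G \<A> \<sigma>" and Y: "Y \<in> m_part G \<A> \<sigma>"
  shows "lie_bracket X Y \<in> k_part G \<A> \<sigma>"
proof -
  have XY: "X \<in> lie_algebra G \<A>" "Y \<in> lie_algebra G \<A>"
    using X Y by (auto simp: m_part_def)
  then have vf: "X \<in> vector_fields \<A>" "Y \<in> vector_fields \<A>"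
    by (auto simp: lie_algebra_def)
  have X': "X (f \<circ> \<sigma>) = - (X f \<circ> \<sigma>)" and Y': "Y (f \<circ> \<sigma>) = - (Y f \<circ> \<sigma>)" for f
    using X Y by (simp_all add: m_part_def pushforward_eq_iff[OF sigma])
      (simp_all add: fun_eq_iff)
  \<comment> \<open>Up to sign these functions are the values \<open>X (f \<circ> \<sigma>)\<close>
    and \<open>Y (f \<circ> \<sigma>)\<close>, and values of vector fields are smooth. Smoothness is
    what lets the other field pull out the minus sign.\<close>
  have "X f \<circ> \<sigma> \<in> smooth_functions \<A>" "Y f \<circ> \<sigma> \<in> smooth_functions \<A>" for f
    using smooth_functions_scaleR[OF assms(1) vector_field_smooth[OF vf(1)], of "-1" "f \<circ> \<sigma>"]
      smooth_functions_scaleR[OF assms(1) vector_field_smooth[OF vf(2)], of "-1" "f \<circ> \<sigma>"]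
    by (simp_all add: X' Y')
  then have "lie_bracket X Y (f \<circ> \<sigma>) = lie_bracket X Y f \<circ> \<sigma>" for f
    by (simp add: lie_bracket_def X' Y' vector_field_minus[OF vf(1)] vector_field_minus[OF vf(2)]
        fun_eq_iff)
  then show ?thesis
    using lie_bracket_in_lie_algebra[OF assms(1) XY]
    by (simp add: k_part_def pushforward_eq_iff[OF sigma])
qed

text \<open>Here only \<open>X\<close> changes sign when moved past \<open>\<sigma>\<close>, so
  exactly one sign survives.\<close>

lemma bracket_k_m:
  assumes "smooth_atlas \<A>" and sigma: "\<sigma> \<circ> \<sigma> = id"
    and A: "A \<in> k_part G \<A> \<sigma>" and X: "X \<in> m_part G \<A> \<sigma>"
  shows "lie_bracket A X \<in> m_part G \<A> \<sigma>"
proof -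
  have AX: "A \<in> lie_algebra G \<A>" "X \<in> lie_algebra G \<A>"
    using A X by (auto simp: k_part_def m_part_def)
  then have vf: "A \<in> vector_fields \<A>" "X \<in> vector_fields \<A>"
    by (auto simp: lie_algebra_def)
  have A': "A (f \<circ> \<sigma>) = A f \<circ> \<sigma>" and X': "X (f \<circ> \<sigma>) = - (X f \<circ> \<sigma>)" for f
    using A X by (simp_all add: k_part_def m_part_def pushforward_eq_iff[OF sigma])
      (simp add: fun_eq_iff)
  have "X f \<circ> \<sigma> \<in> smooth_functions \<A>" for f
    using smooth_functions_scaleR[OF assms(1) vector_field_smooth[OF vf(2)], of "-1" "f \<circ> \<sigma>"]
    by (simp add: X')
  then have "lie_bracket A X (f \<circ> \<sigma>) = (- lie_bracket A X) f \<circ> \<sigma>" for f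
    by (simp add: lie_bracket_def A' X' vector_field_minus[OF vf(1)] fun_eq_iff)
  then show ?thesis
    using lie_bracket_in_lie_algebra[OF assms(1) AX]
    by (simp add: m_part_def pushforward_eq_iff[OF sigma])
qed

section \<open>Bilinear forms and tensors\<close>

lemma sum_fun_apply: "(\<Sum>i\<in>I. F i) x = (\<Sum>i\<in>I. F i x)"
  for F :: "'i \<Rightarrow> 'a \<Rightarrow> 'b::comm_monoid_add"
  by (induction I rule: infinite_finite_induct) simp_all

lemma bilinear_on_scaleR_left:
  "\<lbrakk>bilinear_on U V b; x \<in> U; y \<in> V\<rbrakk> \<Longrightarrow> b (c *\<^sub>R x) y = c * b x y"
  by (simp add: bilinear_on_def)

lemma bilinear_on_scaleR_right:
  "\<lbrakk>bilinear_on U V b; x \<in> U; y \<in> V\<rbrakk> \<Longrightarrow> b x (c *\<^sub>R y) = c * b x y"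
  by (simp add: bilinear_on_def)

lemma bilinear_on_sum_left:
  assumes "bilinear_on U V b" "subspace U" "y \<in> V" "\<And>i. i \<in> I \<Longrightarrow> x i \<in> U"
  shows "b (\<Sum>i\<in>I. r i *\<^sub>R x i) y = (\<Sum>i\<in>I. r i * b (x i) y)"
  using assms(4)
proof (induction I rule: infinite_finite_induct)
  case (insert i I)
  moreover have "(\<Sum>i\<in>I. r i *\<^sub>R x i) \<in> U" "r i *\<^sub>R x i \<in> U"
    using insert assms(2) by (auto intro: subspace_sum subspace_scale)
  ultimately show ?case
    using assms(1,3) by (simp add: bilinear_on_def)
qed (use assms(1-3) subspace_0 in \<open>force simp: bilinear_on_def\<close>)+

lemma bilinear_on_flip: "bilinear_on U V b \<Longrightarrow> bilinear_on V U (\<lambda>y x. b x y)"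
  unfolding bilinear_on_def by blast

lemma bilinear_on_sum_right:
  assumes "bilinear_on U V b" "subspace V" "x \<in> U" "\<And>i. i \<in> I \<Longrightarrow> y i \<in> V"
  shows "b x (\<Sum>i\<in>I. r i *\<^sub>R y i) = (\<Sum>i\<in>I. r i * b x (y i))"
  using bilinear_on_sum_left[OF bilinear_on_flip[OF assms(1)] assms(2-4)] .

text \<open>Pairing an expansion of \<open>x\<close> with a basis vector \<open>f\<close> isolates
  its coefficient times \<open>b f f\<close>. This factor is 1 or -1, hence its own inverse, which
  accounts for the sign in the indefinite case.\<close>

lemma orthonormal_expansion:
  assumes "nondegenerate_symmetric_form V b" "orthonormal_basis_of V b E" "x \<in> V"
  shows "x = (\<Sum>e\<in>E. (b e e * b x e) *\<^sub>R e)"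
proof -
  have E: "finite E" "independent E" "span E = V"
    and sq: "\<And>e. e \<in> E \<Longrightarrow> b e e = 1 \<or> b e e = -1"
    and orth: "\<And>e f. \<lbrakk>e \<in> E; f \<in> E; e \<noteq> f\<rbrakk> \<Longrightarrow> b e f = 0"
    using assms(2) by (auto simp: orthonormal_basis_of_def)
  have sub: "subspace V" and EV: "E \<subseteq> V"
    using E(3) span_superset by auto
  obtain r where x: "x = (\<Sum>e\<in>E. r e *\<^sub>R e)"
    using assms(3) E span_finite[OF E(1)] by auto
  have "b x f = r f * b f f" if "f \<in> E" for f
  proof -
    have "b x f = (\<Sum>e\<in>E. r e * b e f)"
      unfolding x using assms(1) sub EV that
      by (intro bilinear_on_sum_left[of V V]) (auto simp: nondegenerate_symmetric_form_def)
    also have "\<dots> = (\<Sum>e\<in>E. if e = f then r f * b f f else 0)"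
      using orth that by (intro sum.cong) auto
    finally show ?thesis
      using E(1) that by simp
  qed
  then have "b f f * b x f = r f" if "f \<in> E" for f
    using sq[OF that] that by auto
  then show ?thesis
    using x by (metis (no_types, lifting) sum.cong)
qed

section \<open>Uniqueness of the tensor corresponding to a curvature-type map\<close>

lemma endomorphisms_subspace:
  assumes "subspace V"
  shows "subspace (endomorphisms V)"
  using assms unfolding subspace_def endomorphisms_def
  by (auto simp: scaleR_add_right)

text \<open>This is injectivity of the correspondence. Tensors are functionals on bilinear forms, so
  vanishing is tested on each \<open>b\<close>. The index set is an arbitrary finite one so that a
  difference of two sums can be indexed by a disjoint union.\<close>

lemma corresponds_zero_imp_bilinear_zero:
  assumes V: "subspace V" and g: "nondegenerate_symmetric_form V g" and fin: "finite I"
    and AB: "\<And>i. i \<in> I \<Longrightarrow> A i \<in> endomorphisms V \<and> B i \<in> endomorphisms V"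
    and zero: "\<And>X Y Z. \<lbrakk>X \<in> V; Y \<in> V; Z \<in> V\<rbrakk> \<Longrightarrow> (\<Sum>i\<in>I. g X (A i Y) *\<^sub>R B i Z) = 0"
    and b: "bilinear_on (endomorphisms V) (endomorphisms V) b"
  shows "(\<Sum>i\<in>I. b (A i) (B i)) = 0"
proof -
  let ?W = "endomorphisms V"
  have W: "subspace ?W"
    by (rule endomorphisms_subspace[OF V])
  \<comment> \<open>Selecting \<open>C\<close> from the finitely many \<open>B i\<close> makes it a
    finite basis of their span.\<close>
  obtain C where C: "C \<subseteq> B ` I" "independent C" "B ` I \<subseteq> span C"
    using maximal_independent_subset by blast
  have finC: "finite C" and CW: "C \<subseteq> ?W"
    using C(1) fin AB by (auto intro: finite_subset)
  have "\<forall>i\<in>I. \<exists>r. B i = (\<Sum>c\<in>C. r c *\<^sub>R c)"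
    using C(3) span_finite[OF finC] by auto
  then obtain r where r: "\<And>i. i \<in> I \<Longrightarrow> B i = (\<Sum>c\<in>C. r i c *\<^sub>R c)"
    by metis
  \<comment> \<open>\<open>A' c\<close> collects what stands next to \<open>c\<close> when every
    \<open>B i\<close> is expanded in \<open>C\<close>, so that the tensor becomes the sum of
    \<open>A' c\<close> tensor \<open>c\<close>.\<close>
  define A' where "A' c = (\<Sum>i\<in>I. r i c *\<^sub>R A i)" for c
  have A'W: "A' c \<in> ?W" for c
    unfolding A'_def using AB W by (auto intro!: subspace_sum subspace_scale)
  have "A' c = 0" if "c \<in> C" for c
  proof
    fix Y
    show "A' c Y = 0 Y"
    proof (cases "Y \<in> V")
      case True
      have "g X (A' c Y) = 0" if "X \<in> V" for X
      proof -
        have expand: "g X (A' d Y) = (\<Sum>i\<in>I. r i d * g X (A i Y))" for d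
          unfolding A'_def sum_fun_apply scaleR_fun_apply
          using g V AB that True
          by (intro bilinear_on_sum_right[of V V])
            (auto simp: nondegenerate_symmetric_form_def endomorphisms_def)
        \<comment> \<open>Independence of \<open>C\<close> concerns functions on the whole type.
          Inside \<open>V\<close> the hypothesis \<open>zero\<close> applies after regrouping;
          outside \<open>V\<close> every endomorphism is 0 by convention.\<close>
        have "(\<Sum>d\<in>C. g X (A' d Y) *\<^sub>R d) Z = 0" for Z
        proof (cases "Z \<in> V")
          case True
          have "(\<Sum>d\<in>C. g X (A' d Y) *\<^sub>R d) Z =
              (\<Sum>d\<in>C. \<Sum>i\<in>I. (r i d * g X (A i Y)) *\<^sub>R d Z)"
            by (simp add: sum_fun_apply expand scaleR_sum_left)
          also have "\<dots> = (\<Sum>i\<in>I. \<Sum>d\<in>C. (r i d * g X (A i Y)) *\<^sub>R d Z)"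
            by (rule sum.swap)
          also have "\<dots> = (\<Sum>i\<in>I. g X (A i Y) *\<^sub>R B i Z)"
            by (intro sum.cong refl)
              (simp add: r sum_fun_apply scaleR_sum_right mult.commute)
          finally show ?thesis
            using zero \<open>X \<in> V\<close> \<open>Y \<in> V\<close> True by simp
        next
          case False
          then have "d Z = 0" if "d \<in> C" for d
            using CW that by (auto simp: endomorphisms_def)
          then show ?thesis
            by (simp add: sum_fun_apply sum.neutral)
        qed
        then have "(\<Sum>d\<in>C. g X (A' d Y) *\<^sub>R d) = 0"
          by (simp add: fun_eq_iff)
        then show ?thesis
          using independentD[OF C(2) finC subset_refl, of "\<lambda>d. g X (A' d Y)" c] \<open>c \<in> C\<close> by simp
      qed
      moreover have "A' c Y \<in> V"
        using A'W True by (simp add: endomorphisms_def)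
      ultimately show ?thesis
        using g by (simp add: nondegenerate_symmetric_form_def)
    next
      case False
      then show ?thesis
        using A'W by (simp add: endomorphisms_def)
    qed
  qed
  moreover have "b 0 c = 0" if "c \<in> C" for c
  proof -
    have "c \<in> ?W"
      using CW that by auto
    then show ?thesis
      using bilinear_on_scaleR_left[OF b subspace_0[OF W], of c 0] by simp
  qed
  moreover have "(\<Sum>i\<in>I. b (A i) (B i)) = (\<Sum>c\<in>C. b (A' c) c)"
  proof -
    have "(\<Sum>i\<in>I. b (A i) (B i)) = (\<Sum>i\<in>I. \<Sum>c\<in>C. r i c * b (A i) c)"
      using AB CW r by (intro sum.cong refl) (auto intro!: bilinear_on_sum_right[OF b W])
    also have "\<dots> = (\<Sum>c\<in>C. \<Sum>i\<in>I. r i c * b (A i) c)"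
      by (rule sum.swap)
    also have "\<dots> = (\<Sum>c\<in>C. b (A' c) c)"
      unfolding A'_def using AB CW
      by (intro sum.cong refl bilinear_on_sum_left[OF b W, symmetric]) auto
    finally show ?thesis .
  qed
  ultimately show ?thesis
    by simp
qed

lemma tensor_corresponds_unique:
  assumes V: "subspace V" and g: "nondegenerate_symmetric_form V g"
    and "tensor_corresponds V g T R" "tensor_corresponds V g T' R"
  shows "T = T'"
proof
  fix b
  let ?W = "endomorphisms V"
  obtain n A B where T: "T = (\<Sum>s<(n::nat). pure_tensor ?W ?W (A s) (B s))"
    and AB: "\<And>s. s < n \<Longrightarrow> A s \<in> ?W \<and> B s \<in> ?W"
    and R: "\<And>X Y Z. \<lbrakk>X \<in> V; Y \<in> V; Z \<in> V\<rbrakk> \<Longrightarrow> R X Y Z = (\<Sum>s<n. g X (A s Y) *\<^sub>R B s Z)"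
    using assms(3) unfolding tensor_corresponds_def
    by (elim exE conjE) (rule that, assumption, blast+)
  obtain n' A' B' where T': "T' = (\<Sum>s<(n'::nat). pure_tensor ?W ?W (A' s) (B' s))"
    and AB': "\<And>s. s < n' \<Longrightarrow> A' s \<in> ?W \<and> B' s \<in> ?W"
    and R': "\<And>X Y Z. \<lbrakk>X \<in> V; Y \<in> V; Z \<in> V\<rbrakk> \<Longrightarrow> R X Y Z = (\<Sum>s<n'. g X (A' s Y) *\<^sub>R B' s Z)"
    using assms(4) unfolding tensor_corresponds_def
    by (elim exE conjE) (rule that, assumption, blast+)
  show "T b = T' b"
  proof (cases "bilinear_on ?W ?W b")
    case True
    have W: "subspace ?W"
      by (rule endomorphisms_subspace[OF V])
    \<comment> \<open>The two representations are concatenated over a disjoint union, with the minus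
      sign of the difference put into the first tensor factor.\<close>
    define C where "C = case_sum A (\<lambda>s. - A' s)"
    define D where "D = case_sum B B'"
    let ?I = "{..<n} <+> {..<n'}"
    have gV: "bilinear_on V V g"
      using g by (simp add: nondegenerate_symmetric_form_def)
    have neg: "g X (- Y) = - g X Y" if "X \<in> V" "Y \<in> V" for X Y
      using bilinear_on_scaleR_right[OF gV that, of "-1"] by simp
    have negb: "b (- P) Q = - b P Q" if "P \<in> ?W" "Q \<in> ?W" for P Q
      using bilinear_on_scaleR_left[OF True that, of "-1"] by simp
    have "(\<Sum>i\<in>?I. b (C i) (D i)) = 0"
    proof (rule corresponds_zero_imp_bilinear_zero[OF V g _ _ _ True])
      show "C i \<in> ?W \<and> D i \<in> ?W" if "i \<in> ?I" for i
        using that AB AB' subspace_neg[OF W] by (auto simp: C_def D_def)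
      show "(\<Sum>i\<in>?I. g X (C i Y) *\<^sub>R D i Z) = 0" if "X \<in> V" "Y \<in> V" "Z \<in> V" for X Y Z
      proof -
        have "A' s Y \<in> V" if "s < n'" for s
          using AB' that \<open>Y \<in> V\<close> by (simp add: endomorphisms_def)
        then have "(\<Sum>s<n'. g X (- A' s Y) *\<^sub>R B' s Z) = - (\<Sum>s<n'. g X (A' s Y) *\<^sub>R B' s Z)"
          by (simp add: neg \<open>X \<in> V\<close> sum_negf)
        then show ?thesis
          using R[OF that] R'[OF that] by (simp add: sum.Plus C_def D_def)
      qed
    qed simp
    then have "(\<Sum>s<n. b (A s) (B s)) + (\<Sum>s<n'. - b (A' s) (B' s)) = 0"
      using AB' by (simp add: sum.Plus C_def D_def negb)
    then show ?thesis
      using True by (simp add: T T' sum_fun_apply pure_tensor_def sum_negf)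
  next
    \<comment> \<open>Off the bilinear forms both tensors take the default value 0 of
      \<open>pure_tensor\<close>.\<close>
    case False
    then show ?thesis
      by (simp add: T T' sum_fun_apply pure_tensor_def)
  qed
qed

section \<open>The represented Casimir element corresponds to the curvature\<close>

theorem theorem2p2:
  fixes G :: "('g::{t2_space, second_countable_topology}) monoid"
    and \<A> :: "('g, 'e::real_normed_vector) chart set"
    and K :: "'g set" and \<sigma> :: "'g \<Rightarrow> 'g"
    and \<kk> \<mm> :: "'g operator set"
    and g \<beta> :: "'g operator \<Rightarrow> 'g operator \<Rightarrow> real"
    and t :: "('g operator, 'g operator) tensor"
  assumes "semi_riemannian_symmetric_pair G \<A> K \<sigma>"
    and "\<kk> = k_part G \<A> \<sigma>" and "\<mm> = m_part G \<A> \<sigma>"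
    and "base_point_metric G \<A> K \<sigma> g"
    and "nondegenerate_symmetric_form \<kk> \<beta>" and "ad_invariant_form \<kk> \<beta>"
    and "compatible_forms \<kk> \<mm> \<beta> g"
    and "casimir_element \<kk> \<beta> t"
  shows "curvature_tensor \<mm> g =
    tensor_map (endomorphisms \<mm>) (endomorphisms \<mm>) (adjoint_rep \<mm>) (adjoint_rep \<mm>) t"
proof -
  let ?W = "endomorphisms \<mm>"
  have atlas: "smooth_atlas \<A>" and sigma: "\<sigma> \<circ> \<sigma> = id"
    using assms(1) by (auto simp: semi_riemannian_symmetric_pair_def lie_group_def)
  have g: "nondegenerate_symmetric_form \<mm> g"
    using assms(3,4) by (simp add: base_point_metric_def)
  have m: "subspace \<mm>"
    using m_part_subspace[OF atlas sigma] assms(3) by simp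
  have mm: "lie_bracket X Y \<in> \<kk>" if "X \<in> \<mm>" "Y \<in> \<mm>" for X Y
    using bracket_m_m[OF atlas sigma] that assms(2,3) by simp
  have km: "lie_bracket A X \<in> \<mm>" if "A \<in> \<kk>" "X \<in> \<mm>" for A X
    using bracket_k_m[OF atlas sigma] that assms(2,3) by simp
  have vf: "\<kk> \<subseteq> vector_fields \<A>" "\<mm> \<subseteq> vector_fields \<A>"
    using assms(2,3) by (auto simp: k_part_def m_part_def lie_algebra_def)
  note [simp] = vf[THEN subsetD] km mm
  have ad: "adjoint_rep \<mm> A \<in> ?W" if "A \<in> \<kk>" for A
    using that subspace_add[OF m] subspace_scale[OF m]
    by (simp add: endomorphisms_def adjoint_rep_def lie_bracket_add_right[of _ \<A>]
        lie_bracket_scaleR_right[of _ \<A>])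
  have ad_add: "adjoint_rep \<mm> (A + B) = adjoint_rep \<mm> A + adjoint_rep \<mm> B"
    if "A \<in> \<kk>" "B \<in> \<kk>" for A B
    unfolding adjoint_rep_def using that
    by (auto simp: fun_eq_iff[of "\<lambda>X. if X \<in> \<mm> then _ X else _ X"] lie_bracket_add_left[of _ \<A>])
  have ad_scaleR: "adjoint_rep \<mm> (c *\<^sub>R A) = c *\<^sub>R adjoint_rep \<mm> A" if "A \<in> \<kk>" for c A
    unfolding adjoint_rep_def using that
    by (auto simp: fun_eq_iff[of "\<lambda>X. if X \<in> \<mm> then _ X else _ X"] lie_bracket_scaleR_left[of _ \<A>])
  obtain E where E: "orthonormal_basis_of \<kk> \<beta> E"
    and t: "t = (\<Sum>e\<in>E. \<beta> e e *\<^sub>R pure_tensor \<kk> \<kk> e e)"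
    using assms(8) by (auto simp: casimir_element_def)
  have finE: "finite E" and Ek: "\<And>e. e \<in> E \<Longrightarrow> e \<in> \<kk>"
    using E span_superset by (auto simp: orthonormal_basis_of_def)
  \<comment> \<open>\<open>tensor_corresponds\<close> asks for a sum over an initial segment of the
    naturals, so the basis is enumerated.\<close>
  obtain h where h: "bij_betw h {..<card E} E"
    using ex_bij_betw_nat_finite[OF finE] by (auto simp: atLeast0LessThan)
  have hk: "h s \<in> \<kk>" if "s < card E" for s
    using h that Ek by (auto simp: bij_betw_def)
  define B where "B s = adjoint_rep \<mm> (h s)" for s
  \<comment> \<open>The sign of the basis vector goes into the first factor, where \<open>g\<close>
    will pick it up as a scalar.\<close>
  define A where "A s = \<beta> (h s) (h s) *\<^sub>R B s" for s
  let ?T = "tensor_map ?W ?W (adjoint_rep \<mm>) (adjoint_rep \<mm>) t"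
  have BW: "B s \<in> ?W" and AW: "A s \<in> ?W" if "s < card E" for s
    using that ad hk subspace_scale[OF endomorphisms_subspace[OF m]]
    by (auto simp: A_def B_def)
  have "?T = (\<Sum>s<card E. pure_tensor ?W ?W (A s) (B s))"
  proof
    fix b
    show "?T b = (\<Sum>s<card E. pure_tensor ?W ?W (A s) (B s)) b"
    proof (cases "bilinear_on ?W ?W b")
      case True
      \<comment> \<open>\<open>tensor_map\<close> evaluates \<open>t\<close> at this pulled-back
        form. It is bilinear by linearity of the representation, so the pure tensors in
        \<open>t\<close> return its actual values and not their default 0.\<close>
      have "bilinear_on \<kk> \<kk> (\<lambda>u v. b (adjoint_rep \<mm> u) (adjoint_rep \<mm> v))"
        using True ad unfolding bilinear_on_def by (simp add: ad_add ad_scaleR)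
      then have "?T b = (\<Sum>e\<in>E. \<beta> e e * b (adjoint_rep \<mm> e) (adjoint_rep \<mm> e))"
        using True by (simp add: tensor_map_def t sum_fun_apply pure_tensor_def)
      also have "\<dots> = (\<Sum>s<card E. \<beta> (h s) (h s) * b (B s) (B s))"
        unfolding B_def by (rule sum.reindex_bij_betw[OF h, symmetric])
      also have "\<dots> = (\<Sum>s<card E. b (A s) (B s))"
        using bilinear_on_scaleR_left[OF True BW BW] by (intro sum.cong) (simp_all add: A_def)
      finally show ?thesis
        using True by (simp add: sum_fun_apply pure_tensor_def)
    next
      case False
      then show ?thesis
        by (simp add: tensor_map_def sum_fun_apply pure_tensor_def)
    qed
  qed
  moreover have "curvature X Y Z = (\<Sum>s<card E. g X (A s Y) *\<^sub>R B s Z)"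
    if XYZ: "X \<in> \<mm>" "Y \<in> \<mm>" "Z \<in> \<mm>" for X Y Z
  proof -
    have scale: "g X (c *\<^sub>R U) = c * g X U" if "U \<in> \<mm>" for c U
      using g XYZ that
      by (simp add: nondegenerate_symmetric_form_def bilinear_on_scaleR_right[of \<mm> \<mm>])
    have coeff: "\<beta> (lie_bracket X Y) e = - g X (lie_bracket e Y)" if "e \<in> E" for e
    proof -
      have "\<beta> (lie_bracket X Y) e = g X (lie_bracket Y e)"
        using assms(7) XYZ Ek that by (simp add: compatible_forms_def)
      also have "lie_bracket Y e = (-1) *\<^sub>R lie_bracket e Y"
        by (subst lie_bracket_minus_swap) simp
      also have "g X ((-1) *\<^sub>R lie_bracket e Y) = (-1) * g X (lie_bracket e Y)"
        using Ek that XYZ by (intro scale km)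
      finally show ?thesis
        by simp
    qed
    have "- lie_bracket X Y = - (\<Sum>e\<in>E. (\<beta> e e * \<beta> (lie_bracket X Y) e) *\<^sub>R e)"
      by (rule arg_cong[OF orthonormal_expansion[OF assms(5) E mm[OF XYZ(1,2)]]])
    moreover have "(\<Sum>e\<in>E. (\<beta> e e * \<beta> (lie_bracket X Y) e) *\<^sub>R e) =
        - (\<Sum>e\<in>E. (\<beta> e e * g X (lie_bracket e Y)) *\<^sub>R e)"
      unfolding sum_negf[symmetric] by (intro sum.cong refl) (simp only: coeff, simp)
    ultimately have XY: "- lie_bracket X Y = (\<Sum>e\<in>E. (\<beta> e e * g X (lie_bracket e Y)) *\<^sub>R e)"
      by (simp only: minus_minus)
    \<comment> \<open>The minus sign in the curvature is absorbed into the left slot of the bracket,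
      where it cancels the one from \<open>coeff\<close>.\<close>
    have "curvature X Y Z = lie_bracket (- lie_bracket X Y) Z"
      using lie_bracket_scaleR_left[of "lie_bracket X Y" \<A> Z "-1"] XYZ
      by (simp add: curvature_def)
    also have "\<dots> = (\<Sum>e\<in>E. (\<beta> e e * g X (lie_bracket e Y)) *\<^sub>R lie_bracket e Z)"
      unfolding XY using Ek XYZ by (intro lie_bracket_sum_left[OF atlas]) simp_all
    also have "\<dots> = (\<Sum>s<card E. (\<beta> (h s) (h s) * g X (lie_bracket (h s) Y)) *\<^sub>R lie_bracket (h s) Z)"
      by (rule sum.reindex_bij_betw[OF h, symmetric])
    also have "\<dots> = (\<Sum>s<card E. g X (A s Y) *\<^sub>R B s Z)"
      using XYZ hk by (intro sum.cong refl) (simp add: A_def B_def adjoint_rep_def scale)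
    finally show ?thesis .
  qed
  ultimately have "tensor_corresponds \<mm> g ?T curvature"
    using AW BW unfolding tensor_corresponds_def by blast
  \<comment> \<open>\<open>curvature_tensor\<close> is a definite description: existence has just
    been exhibited, and nondegeneracy of \<open>g\<close> gives uniqueness.\<close>
  then show ?thesis
    unfolding curvature_tensor_def
    by (intro the_equality) (auto intro: tensor_corresponds_unique[OF m g])
qed

end
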